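(* Let $n=2$ and let $\mathcal{M}=\{A_1,\dots,A_m\}\subset\mathbb{R}^{2\times 2}$ be a finite set of nonsingular matrices. For $h=1,\dots,m$ let $\delta_h$ denote the smallest singular value of $A_h$. Assume that: (1) there exists $A\in\bigcup_{k\in\mathbb{N}}\mathcal{M}^k$ with nonreal eigenvalues such that $A^l$ is not proportional to the identity for every nonzero integer $l$; (2) there is a single index $\bar h$ satisfying $\min_{h=1,\dots,m}\delta_h=\delta_{\bar h}$, with $A_{\bar h}$ diagonal and not proportional to the identity. Then $\tilde\rho_x(\mathcal{M})$, as a function of $x$, is discontinuous at each point of $\mathbb{R}^2$.
   Context: Given a finite set $\mathcal{M}=\{A_1,\dots,A_m\}\subset\mathbb{R}^{n\times n}$, a solution of the associated discrete-time linear switched system starting at $x_0\in\mathbb{R}^n$ is a sequence $(x(k))_{k\ge 0}$ with $x(0)=x_0$ and $x(k+1)=A_{\sigma_k}x(k)$ for all $k\ge 0$, for some switching signal $\sigma$ with $\sigma_k\in\{1,\dots,m\}$ (the signal may be chosen depending on $x_0$). Let $|\cdot|$ be the Euclidean norm. For $x_0\in\mathbb{R}^n$ define $$\tilde\rho_{x_0}(\mathcal{M})=\inf\{\lambda\ge 0 : \exists\text{ a solution } x(\cdot)\text{ starting at }x_0\text{ and } M>0 \text{ such that } |x(k)|\le M\lambda^k|x_0|\ \text{for all } k\ge 0\}.$$ $\mathcal{M}^k$ denotes the set of all products of $k$ matrices of $\mathcal{M}$.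
   Formalization: The formal theorem also assumes that the diagonal matrix with the smallest singular value is not a multiple of diag(1,-1); in that case the growth rate is constant away from the origin, so the claim as stated fails. *)

theory Defs
  imports "HOL-Analysis.Analysis"
begin

(* On real^'n^'n the library's * and ^ act componentwise, so matrix powers are built from **. *)
primrec mat_pow :: "'a::semiring_1^'n^'n \<Rightarrow> nat \<Rightarrow> 'a^'n^'n" where
  "mat_pow A 0 = mat 1"
| "mat_pow A (Suc k) = A ** mat_pow A k"

(* Intended for invertible A. *)
definition mat_powi :: "'a::semiring_1^'n^'n \<Rightarrow> int \<Rightarrow> 'a^'n^'n" where
  "mat_powi A l = (if 0 \<le> l then mat_pow A (nat l) else mat_pow (matrix_inv A) (nat (- l)))"

definition mat_eigenvalue :: "'a::field^'n^'n \<Rightarrow> 'a \<Rightarrow> bool" where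
  "mat_eigenvalue A \<mu> \<longleftrightarrow> (\<exists>v. v \<noteq> 0 \<and> A *v v = \<mu> *s v)"

definition has_nonreal_eigenvalue :: "real^'n^'n \<Rightarrow> bool" where
  "has_nonreal_eigenvalue A \<longleftrightarrow>
     (\<exists>\<mu>. mat_eigenvalue (map_matrix complex_of_real A) \<mu> \<and> \<mu> \<notin> \<real>)"

definition proportional_to_id :: "real^'n^'n \<Rightarrow> bool" where
  "proportional_to_id A \<longleftrightarrow> (\<exists>c. A = c *\<^sub>R mat 1)"

definition is_diagonal :: "real^'n^'n \<Rightarrow> bool" where
  "is_diagonal A \<longleftrightarrow> (\<forall>i j. i \<noteq> j \<longrightarrow> A $ i $ j = 0)"

definition singular_values :: "real^'n^'n \<Rightarrow> real set" where
  "singular_values A = {sqrt \<mu> | \<mu>. mat_eigenvalue (transpose A ** A) \<mu>}"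

definition min_singular_value :: "real^'n^'n \<Rightarrow> real" where
  "min_singular_value A = Min (singular_values A)"

(* The finite matrix set is given as the family A 1, ..., A m throughout. *)
primrec mat_products :: "(nat \<Rightarrow> real^'n^'n) \<Rightarrow> nat \<Rightarrow> nat \<Rightarrow> (real^'n^'n) set" where
  "mat_products A m 0 = {mat 1}"
| "mat_products A m (Suc k) = {A h ** P | h P. h \<in> {1..m} \<and> P \<in> mat_products A m k}"

definition switched_solution ::
    "(nat \<Rightarrow> real^'n^'n) \<Rightarrow> nat \<Rightarrow> real^'n \<Rightarrow> (nat \<Rightarrow> real^'n) \<Rightarrow> bool" where
  "switched_solution A m x0 x \<longleftrightarrow>
     x 0 = x0 \<and> (\<exists>\<sigma>. \<forall>k. \<sigma> k \<in> {1..m} \<and> x (Suc k) = A (\<sigma> k) *v x k)"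

definition rho_tilde :: "(nat \<Rightarrow> real^'n^'n) \<Rightarrow> nat \<Rightarrow> real^'n \<Rightarrow> real" where
  "rho_tilde A m x0 = Inf {r. 0 \<le> r \<and>
     (\<exists>x M. switched_solution A m x0 x \<and> M > 0 \<and> (\<forall>k. norm (x k) \<le> M * r ^ k * norm x0))}"

end

theory Submission
  imports Defs
begin

text \<open>
  The function \<open>rho_tilde\<close> takes values at most \<open>\<delta>\<close> on one dense set and values at least some
  \<open>\<gamma> > \<delta>\<close> on another, where \<open>\<delta>\<close> is the smallest singular value of the distinguished matrix
  \<open>A hb\<close>. Two dense sets with such a gap between them exclude continuity at every point, the
  origin included.

  \<^emph>\<open>Low values.\<close> Since \<open>A hb\<close> is diagonal, it multiplies one coordinate axis by \<open>\<plusminus>\<delta>\<close>, so every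
  point of that axis has a solution of growth rate \<open>\<delta>\<close>. A finite initial piece of a solution only
  changes the constant in front of the exponential (lemma \<open>growth_rate_mat_pow\<close>), so the same holds
  for every point that some power of \<open>B\<close>, a product with nonreal eigenvalues, maps onto the axis.
  In a suitable complex coordinate \<open>B\<close> is multiplication by a number whose argument is an
  irrational multiple of \<open>\<pi>\<close>, and Kronecker's theorem makes these preimages of the axis dense
  (lemma \<open>preimages_of_line_dense\<close>).

  \<^emph>\<open>High values.\<close> Almost every point has growth rate at least \<open>\<gamma>\<close>. A matrix \<open>A h\<close> shrinks no
  vector by more than a factor \<open>\<delta> h\<close>, but it changes areas by the factor \<open>\<bar>det (A h)\<bar>\<close>. To keep a
  solution near the rate \<open>\<delta>\<close>, almost all steps have to use \<open>A hb\<close>, whose singular values differ,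
  so that \<open>\<delta>\<^sup>2 < \<bar>det (A hb)\<bar>\<close>: the disc of radius about \<open>\<delta>\<^sup>k\<close> in which the solution has to end
  has a preimage of exponentially small area. The price for the few other steps is the number of
  words, and a Chernoff-type weight settles it. On points of norm at least \<open>r\<close> the factor
  \<open>(t / r)\<^sup>s\<close> turns each letter \<open>h\<close> into the cost \<open>1 / (\<bar>det (A h)\<bar> * \<delta> h ^ s)\<close>, and for large \<open>s\<close>
  the strict minimality of \<open>\<delta>\<close> makes all letters but \<open>hb\<close> negligible
  (lemmas \<open>measure_slow_set_le\<close> and \<open>rho_tilde_gap\<close>).
\<close>

section \<open>Singular values of real two by two matrices\<close>

lemma inner_matrix_vector_self:
  fixes A :: "real^'n^'m"
  shows "(A *v v) \<bullet> (A *v v) = v \<bullet> ((transpose A ** A) *v v)"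
  by (metis dot_lmul_matrix matrix_vector_mul_assoc vector_transpose_matrix)

lemma mat_eigenvalue_iff_det:
  fixes A :: "'a::field^'n^'n"
  shows "mat_eigenvalue A \<mu> \<longleftrightarrow> det (A - mat \<mu>) = 0"
proof -
  have mat: "mat \<mu> *v v = \<mu> *s v" for v :: "'a^'n"
    by (simp add: vec_eq_iff matrix_vector_mult_def mat_def if_distrib [of "\<lambda>x. x * _"] cong: if_cong)
  have "det (A - mat \<mu>) \<noteq> 0 \<longleftrightarrow> (\<forall>v. (A - mat \<mu>) *v v = 0 \<longrightarrow> v = 0)"
    by (metis invertible_det_nz invertible_left_inverse matrix_left_invertible_ker)
  then show ?thesis
    unfolding mat_eigenvalue_def by (auto simp: matrix_vector_mult_diff_rdistrib mat)
qed

lemma mat_eigenvalue_2: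
  fixes A :: "'a::field^2^2"
  shows "mat_eigenvalue A \<mu> \<longleftrightarrow> (A$1$1 - \<mu>) * (A$2$2 - \<mu>) = A$1$2 * A$2$1"
  by (simp add: mat_eigenvalue_iff_det det_2 mat_def)

lemma finite_singular_values_2:
  fixes A :: "real^2^2"
  shows "finite (singular_values A)"
proof -
  let ?S = "transpose A ** A"
  let ?p = "[:?S$1$1 * ?S$2$2 - ?S$1$2 * ?S$2$1, - (?S$1$1 + ?S$2$2), 1:]"
  have "{\<mu>. mat_eigenvalue ?S \<mu>} \<subseteq> {\<mu>. poly ?p \<mu> = 0}"
    by (auto simp: mat_eigenvalue_2 algebra_simps)
  moreover have "finite {\<mu>. poly ?p \<mu> = 0}"
    by (rule poly_roots_finite) simp
  ultimately have "finite (sqrt ` {\<mu>. mat_eigenvalue ?S \<mu>})"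
    by (intro finite_imageI) (rule finite_subset)
  then show ?thesis
    by (simp add: singular_values_def setcompr_eq_image)
qed

text \<open>
  The witness is the smaller root of the characteristic polynomial of the Gram matrix. Subtracting
  it from the diagonal leaves a singular form with nonnegative diagonal, which is a perfect square.
\<close>

lemma singular_value_lower_bound_2:
  fixes A :: "real^2^2"
  obtains \<mu> where "mat_eigenvalue (transpose A ** A) \<mu>" "0 \<le> \<mu>"
    "\<And>x. \<mu> * (norm x)\<^sup>2 \<le> (norm (A *v x))\<^sup>2"
proof -
  let ?S = "transpose A ** A"
  define p q r where "p = ?S$1$1" and "q = ?S$1$2" and "r = ?S$2$2"
  define s where "s = sqrt ((p - r)\<^sup>2 + 4 * q\<^sup>2)"
  define \<mu> where "\<mu> = ((p + r) - s) / 2"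
  have sym: "?S$2$1 = q"
    by (simp add: q_def matrix_matrix_mult_def transpose_def sum_2 mult.commute)
  have s2: "s\<^sup>2 = (p - r)\<^sup>2 + 4 * q\<^sup>2"
    by (simp add: s_def)
  have char: "(p - \<mu>) * (r - \<mu>) = q\<^sup>2"
    using s2 unfolding \<mu>_def power2_eq_square by (simp add: field_simps)
  have ev: "mat_eigenvalue ?S \<mu>"
    using char by (simp add: mat_eigenvalue_2 p_def [symmetric] q_def [symmetric] r_def [symmetric]
        sym power2_eq_square)
  have "\<bar>p - r\<bar> \<le> s"
    unfolding s_def by (rule real_le_rsqrt) simp
  then have ge: "0 \<le> p - \<mu>" "0 \<le> r - \<mu>"
    by (auto simp: \<mu>_def)
  have quad: "(norm (A *v x))\<^sup>2 = p * (x$1)\<^sup>2 + 2 * q * (x$1) * (x$2) + r * (x$2)\<^sup>2" for x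
    by (simp add: power2_norm_eq_inner)
      (simp add: inner_vec_def sum_2 matrix_vector_mult_def p_def q_def r_def
        matrix_matrix_mult_def transpose_def power2_eq_square algebra_simps)
  have bound: "\<mu> * (norm x)\<^sup>2 \<le> (norm (A *v x))\<^sup>2" for x
  proof -
    have nx: "(norm x)\<^sup>2 = (x$1)\<^sup>2 + (x$2)\<^sup>2"
      by (simp add: power2_norm_eq_inner) (simp add: inner_vec_def sum_2 power2_eq_square)
    define a b where "a = sqrt (p - \<mu>)" and "b = sqrt (r - \<mu>)"
    have ab: "a\<^sup>2 = p - \<mu>" "b\<^sup>2 = r - \<mu>" "\<bar>q\<bar> = a * b"
      using ge char by (simp_all add: a_def b_def real_sqrt_mult [symmetric])
    have "q = a * b \<or> q = - (a * b)"
      using ab(3) by linarith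
    then have "0 \<le> a\<^sup>2 * (x$1)\<^sup>2 + 2 * q * (x$1) * (x$2) + b\<^sup>2 * (x$2)\<^sup>2"
    proof
      assume "q = a * b"
      then have "a\<^sup>2 * (x$1)\<^sup>2 + 2 * q * (x$1) * (x$2) + b\<^sup>2 * (x$2)\<^sup>2 = (a * x$1 + b * x$2)\<^sup>2"
        by (simp add: power2_eq_square algebra_simps)
      then show ?thesis by simp
    next
      assume "q = - (a * b)"
      then have "a\<^sup>2 * (x$1)\<^sup>2 + 2 * q * (x$1) * (x$2) + b\<^sup>2 * (x$2)\<^sup>2 = (a * x$1 - b * x$2)\<^sup>2"
        by (simp add: power2_eq_square algebra_simps)
      then show ?thesis by simp
    qed
    then show ?thesis
      by (simp add: quad nx ab algebra_simps)
  qed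
  have "0 \<le> \<mu>"
  proof -
    obtain v where v: "v \<noteq> 0" "?S *v v = \<mu> *s v"
      using ev by (auto simp: mat_eigenvalue_def)
    have "\<mu> * (v \<bullet> v) = v \<bullet> (?S *v v)"
      by (simp add: v scalar_mult_eq_scaleR)
    also have "\<dots> = (A *v v) \<bullet> (A *v v)"
      by (simp only: inner_matrix_vector_self)
    finally have "0 \<le> \<mu> * (v \<bullet> v)" by simp
    moreover have "0 < v \<bullet> v" using v(1) by simp
    ultimately show ?thesis
      by (metis mult_le_cancel_right_pos mult_zero_left)
  qed
  with ev show thesis using bound by (rule that)
qed

text \<open>
  The definition of the smallest singular value as a minimum over a set of square roots says nothing
  about vectors. This lemma gives it its metric meaning.
\<close>

lemma norm_mult_ge_min_singular_value_2:
  fixes A :: "real^2^2"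
  shows "min_singular_value A * norm x \<le> norm (A *v x)"
proof -
  obtain \<mu> where \<mu>: "mat_eigenvalue (transpose A ** A) \<mu>" "0 \<le> \<mu>"
    "\<mu> * (norm x)\<^sup>2 \<le> (norm (A *v x))\<^sup>2"
    using singular_value_lower_bound_2 by metis
  have "min_singular_value A \<le> sqrt \<mu>"
    unfolding min_singular_value_def
    using \<mu>(1) finite_singular_values_2 by (intro Min_le) (auto simp: singular_values_def)
  then have "min_singular_value A * norm x \<le> sqrt \<mu> * norm x"
    by (simp add: mult_right_mono)
  also have "\<dots> = sqrt (\<mu> * (norm x)\<^sup>2)"
    by (simp add: real_sqrt_mult)
  also have "\<dots> \<le> norm (A *v x)"
    using \<mu>(3) by (simp add: real_le_lsqrt)
  finally show ?thesis .
qed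

lemma min_singular_value_pos_2:
  fixes A :: "real^2^2"
  assumes "invertible A"
  shows "0 < min_singular_value A"
proof -
  have "singular_values A \<noteq> {}"
    using singular_value_lower_bound_2 [of A] by (auto simp: singular_values_def)
  then have "min_singular_value A \<in> singular_values A"
    unfolding min_singular_value_def using finite_singular_values_2 by (rule Min_in [rotated])
  then obtain \<mu> v where \<mu>: "min_singular_value A = sqrt \<mu>" "v \<noteq> 0" 
      "(transpose A ** A) *v v = \<mu> *s v"
    by (auto simp: singular_values_def mat_eigenvalue_def)
  have "A *v v \<noteq> 0"
    using assms \<mu>(2) by (metis invertible_left_inverse matrix_left_invertible_ker)
  then have "0 < (A *v v) \<bullet> (A *v v)"
    by simp
  also have "(A *v v) \<bullet> (A *v v) = v \<bullet> ((transpose A ** A) *v v)"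
    by (rule inner_matrix_vector_self)
  also have "\<dots> = \<mu> * (v \<bullet> v)"
    by (simp add: \<mu> scalar_mult_eq_scaleR)
  finally show ?thesis
    using \<mu>(1) zero_less_mult_pos2 [of \<mu> "v \<bullet> v"] \<mu>(2) by simp
qed

lemma min_singular_value_diagonal_2:
  fixes A :: "real^2^2"
  assumes "is_diagonal A"
  shows "min_singular_value A = min \<bar>A$1$1\<bar> \<bar>A$2$2\<bar>"
proof -
  have "A$1$2 = 0" "A$2$1 = 0"
    using assms by (simp_all add: is_diagonal_def)
  then have "mat_eigenvalue (transpose A ** A) \<mu> \<longleftrightarrow> \<mu> = (A$1$1)\<^sup>2 \<or> \<mu> = (A$2$2)\<^sup>2" for \<mu>
    by (auto simp: mat_eigenvalue_2 matrix_matrix_mult_def transpose_def sum_2 power2_eq_square)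
  then have "singular_values A = sqrt ` {(A$1$1)\<^sup>2, (A$2$2)\<^sup>2}"
    unfolding singular_values_def by blast
  then show ?thesis
    by (simp add: min_singular_value_def)
qed

section \<open>Irrational rotations and preimages of a line\<close>

text \<open>
  Iterated multiplication by \<open>\<mu>\<close> turns the direction of \<open>\<zeta>\<close> by multiples of \<open>Arg \<mu>\<close>, and only
  directions modulo \<open>\<pi>\<close> matter. A rational \<open>Arg \<mu> / \<pi>\<close> would make some power of \<open>\<mu>\<close> real, so
  the multiples are dense modulo \<open>\<pi>\<close>.
\<close>

lemma irrational_rotation_approx:
  fixes \<mu> w z :: complex
  assumes irr: "\<And>l. 0 < l \<Longrightarrow> \<mu> ^ l \<notin> \<real>" and "w \<noteq> 0" and "0 < \<epsilon>"
  obtains \<zeta> k t where "dist \<zeta> z < \<epsilon>" "\<mu> ^ k * \<zeta> = of_real t * w"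
proof (cases "z = 0")
  case True
  with \<open>0 < \<epsilon>\<close> show thesis
    by (intro that [of 0 0 0]) auto
next
  case False
  have cis_pi: "cis (of_int h * pi) = of_real (cos (of_int h * pi))" for h
  proof -
    have "sin (of_int h * pi) = 0"
      by (auto simp: sin_zero_iff_int2)
    then show ?thesis
      by (simp add: complex_eq_iff)
  qed
  have polar: "\<mu> ^ k = of_real (cmod \<mu> ^ k) * cis (real k * Arg \<mu>)" for k
    using DeMoivre2 [of "cmod \<mu>" "Arg \<mu>" k] unfolding rcis_cmod_Arg by (simp add: rcis_def)
  have "Arg \<mu> / pi \<notin> \<rat>"
  proof
    assume "Arg \<mu> / pi \<in> \<rat>"
    then obtain a b where ab: "0 < b" "Arg \<mu> / pi = of_int a / of_int b"
      by (metis Rats_cases')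
    then have "real (nat b) * Arg \<mu> = of_int a * pi"
      by (simp add: field_simps)
    then have "\<mu> ^ nat b \<in> \<real>"
      by (simp add: polar cis_pi)
    with irr [of "nat b"] ab(1) show False by simp
  qed
  moreover have "0 < \<epsilon> / (pi * cmod z)"
    using False \<open>0 < \<epsilon>\<close> by simp
  ultimately obtain h k where k: "0 < k"
      and close: "\<bar>of_int k * (Arg \<mu> / pi) - of_int h - (Arg w - Arg z) / pi\<bar> < \<epsilon> / (pi * cmod z)"
    by (rule sequence_of_fractional_parts_is_dense)
  define n where "n = nat k"
  have n: "real n = of_int k"
    using k by (simp add: n_def)
  \<comment> \<open>the direction that \<open>n\<close> turns by \<open>Arg \<mu>\<close> carry exactly to the line through \<open>w\<close>\<close>
  define \<beta> where "\<beta> = Arg w - real n * Arg \<mu> + of_int h * pi"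
  have "\<bar>\<beta> - Arg z\<bar> = pi * \<bar>of_int k * (Arg \<mu> / pi) - of_int h - (Arg w - Arg z) / pi\<bar>"
  proof -
    have "\<beta> - Arg z = pi * (- (of_int k * (Arg \<mu> / pi) - of_int h - (Arg w - Arg z) / pi))"
      by (simp add: \<beta>_def n field_simps)
    then show ?thesis
      by (simp only: abs_mult abs_minus_cancel) simp
  qed
  also have "\<dots> < pi * (\<epsilon> / (pi * cmod z))"
    using close by (rule mult_strict_left_mono) simp
  also have "\<dots> = \<epsilon> / cmod z"
    by simp
  finally have small: "\<bar>\<beta> - Arg z\<bar> * cmod z < \<epsilon>"
    using False by (simp add: pos_less_divide_eq)
  show thesis
  proof
    have "dist (rcis (cmod z) \<beta>) z = cmod z * cmod (cis (\<beta> - Arg z) - 1)"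
    proof -
      have "rcis (cmod z) \<beta> - z = rcis (cmod z) \<beta> - rcis (cmod z) (Arg z)"
        by (simp add: rcis_cmod_Arg)
      also have "\<dots> = rcis (cmod z) (Arg z) * (cis (\<beta> - Arg z) - 1)"
        by (simp add: rcis_def right_diff_distrib cis_mult mult.assoc)
      finally show ?thesis
        by (simp add: dist_norm norm_mult)
    qed
    also have "cmod (cis (\<beta> - Arg z) - 1) \<le> \<bar>\<beta> - Arg z\<bar>"
      using dist_exp_i_1 [of "\<beta> - Arg z"] abs_sin_x_le_abs_x [of "(\<beta> - Arg z) / 2"]
      by (simp add: cis_conv_exp)
    then have "cmod z * cmod (cis (\<beta> - Arg z) - 1) \<le> \<bar>\<beta> - Arg z\<bar> * cmod z"
      by (simp add: mult_left_mono mult.commute)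
    also note small
    finally show "dist (rcis (cmod z) \<beta>) z < \<epsilon>" .
    have "real n * Arg \<mu> + \<beta> = Arg w + of_int h * pi"
      by (simp add: \<beta>_def)
    then have "cis (real n * Arg \<mu>) * cis \<beta> = cis (Arg w) * of_real (cos (of_int h * pi))"
      by (metis cis_mult cis_pi)
    then have "\<mu> ^ n * rcis (cmod z) \<beta> =
        of_real (cmod \<mu> ^ n * cmod z * cos (of_int h * pi)) * cis (Arg w)"
      by (simp add: polar rcis_def mult_ac)
    also have "cis (Arg w) = w / of_real (cmod w)"
      using \<open>w \<noteq> 0\<close> by (metis cis_Arg sgn_eq)
    finally show "\<mu> ^ n * rcis (cmod z) \<beta> =
        of_real (cmod \<mu> ^ n * cmod z * cos (of_int h * pi) / cmod w) * w"
      by simp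
  qed
qed

text \<open>
  A left eigenvector of \<open>B\<close> for a nonreal eigenvalue, read as a functional on the plane, is such a
  coordinate. It is bijective because its real and imaginary parts are linearly independent.
\<close>

lemma nonreal_eigenvalue_complex_coordinate:
  fixes B :: "real^2^2"
  assumes "has_nonreal_eigenvalue B"
  obtains \<phi> :: "real^2 \<Rightarrow> complex" and \<mu>
    where "linear \<phi>" "bij \<phi>" "\<And>x. \<phi> (B *v x) = \<mu> * \<phi> x"
proof -
  obtain \<mu> where \<mu>: "mat_eigenvalue (map_matrix complex_of_real B) \<mu>" "\<mu> \<notin> \<real>"
    using assms by (auto simp: has_nonreal_eigenvalue_def)
  let ?a = "B$1$1" and ?b = "B$1$2" and ?c = "B$2$1" and ?d = "B$2$2"
  have char: "(of_real ?a - \<mu>) * (of_real ?d - \<mu>) = of_real ?b * of_real ?c"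
    using \<mu>(1) by (simp add: mat_eigenvalue_2 map_matrix_def)
  have Im: "Im \<mu> \<noteq> 0"
    using \<mu>(2) by (simp add: complex_is_Real_iff)
  have c: "?c \<noteq> 0"
  proof
    assume "?c = 0"
    with char have "\<mu> = of_real ?a \<or> \<mu> = of_real ?d" by auto
    with \<mu>(2) show False by auto
  qed
  \<comment> \<open>pairing with the left eigenvector \<open>(c, \<mu> - a)\<close>\<close>
  define \<phi> where "\<phi> x = of_real (?c * x$1) + (\<mu> - of_real ?a) * of_real (x$2)" for x :: "real^2"
  have lin: "linear \<phi>"
    by (rule linearI; simp add: \<phi>_def; simp add: algebra_simps scaleR_conv_of_real)
  have inj: "inj \<phi>"
  proof (rule injI)
    fix x y :: "real^2"
    assume "\<phi> x = \<phi> y"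
    then have "Re (\<phi> x) = Re (\<phi> y)" "Im (\<phi> x) = Im (\<phi> y)" by auto
    then show "x = y"
      using Im c by (simp add: \<phi>_def vec_eq_iff forall_2)
  qed
  have surj: "surj \<phi>"
  proof (rule surjI)
    fix z
    show "\<phi> (vector [(Re z - (Re \<mu> - ?a) * (Im z / Im \<mu>)) / ?c, Im z / Im \<mu>]) = z"
      using Im c by (simp add: \<phi>_def complex_eq_iff)
  qed
  have "\<phi> (B *v x) = \<mu> * \<phi> x" for x
  proof -
    have "\<phi> (B *v x) - \<mu> * \<phi> x =
        - (((of_real ?a - \<mu>) * (of_real ?d - \<mu>) - of_real ?b * of_real ?c) * of_real (x$2))"
      by (simp add: \<phi>_def matrix_vector_mult_def sum_2 algebra_simps)
    then show ?thesis
      by (simp add: char)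
  qed
  with lin inj surj show thesis
    by (intro that) (auto simp: bij_def)
qed

lemma preimages_of_line_dense:
  fixes B :: "real^2^2" and e x :: "real^2"
  assumes nonreal: "has_nonreal_eigenvalue B"
    and irr: "\<And>l. 0 < l \<Longrightarrow> \<not> proportional_to_id (mat_pow B l)"
    and "e \<noteq> 0" and "0 < \<epsilon>"
  obtains y k t where "dist y x < \<epsilon>" "mat_pow B k *v y = t *\<^sub>R e"
proof -
  obtain \<phi> :: "real^2 \<Rightarrow> complex" and \<mu>
    where lin: "linear \<phi>" and bij: "bij \<phi>" and \<phi>: "\<And>x. \<phi> (B *v x) = \<mu> * \<phi> x"
    using nonreal_eigenvalue_complex_coordinate [OF nonreal] by metis
  have inj: "inj \<phi>"
    using bij by (rule bij_is_inj)
  have pow: "\<phi> (mat_pow B k *v v) = \<mu> ^ k * \<phi> v" for k v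
    by (induction k) (simp_all add: \<phi> matrix_vector_mul_assoc [symmetric])
  have "\<mu> ^ l \<notin> \<real>" if "0 < l" for l
  proof
    assume "\<mu> ^ l \<in> \<real>"
    then obtain c where "\<mu> ^ l = of_real c"
      by (auto elim: Reals_cases)
    then have "\<phi> (mat_pow B l *v v) = c *\<^sub>R \<phi> v" for v
      by (simp add: pow scaleR_conv_of_real)
    then have "\<phi> (mat_pow B l *v v) = \<phi> ((c *\<^sub>R mat 1) *v v)" for v
      using linear_scale [OF lin] by (simp flip: scaleR_matrix_vector_assoc)
    then have "mat_pow B l = c *\<^sub>R mat 1"
      using inj by (simp add: inj_eq matrix_eq)
    with irr [OF that] show False
      by (auto simp: proportional_to_id_def)
  qed
  moreover have "\<phi> e \<noteq> 0"
    using \<open>e \<noteq> 0\<close> inj lin by (metis injD linear_0)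
  moreover obtain b where b: "0 < b" "\<And>v. b * norm v \<le> norm (\<phi> v)"
    using linear_inj_bounded_below_pos [OF lin inj] by metis
  moreover have "0 < b * \<epsilon>"
    using b \<open>0 < \<epsilon>\<close> by simp
  ultimately obtain \<zeta> k t where \<zeta>: "dist \<zeta> (\<phi> x) < b * \<epsilon>" "\<mu> ^ k * \<zeta> = of_real t * \<phi> e"
    using irrational_rotation_approx by blast
  obtain y where y: "\<phi> y = \<zeta>"
    using bij by (metis bij_pointE)
  show thesis
  proof
    have "b * norm (y - x) \<le> dist \<zeta> (\<phi> x)"
      using b(2) [of "y - x"] by (simp add: y linear_diff [OF lin] dist_norm)
    with \<zeta>(1) have "b * norm (y - x) < b * \<epsilon>" by linarith
    with b(1) show "dist y x < \<epsilon>" by (simp add: dist_norm)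
    have "\<phi> (mat_pow B k *v y) = \<phi> (t *\<^sub>R e)"
      using linear_scale [OF lin, of t e] by (simp add: pow y \<zeta>(2) scaleR_conv_of_real)
    then show "mat_pow B k *v y = t *\<^sub>R e"
      using inj by (simp add: inj_eq)
  qed
qed

section \<open>Growth rates of solutions\<close>

definition growth_rate :: "(nat \<Rightarrow> real^'n^'n) \<Rightarrow> nat \<Rightarrow> real^'n \<Rightarrow> real \<Rightarrow> bool" where
  "growth_rate A m x0 r \<longleftrightarrow> 0 \<le> r \<and>
     (\<exists>x M. switched_solution A m x0 x \<and> M > 0 \<and> (\<forall>k. norm (x k) \<le> M * r ^ k * norm x0))"

lemma rho_tilde_eq_Inf: "rho_tilde A m x0 = Inf {r. growth_rate A m x0 r}"
  by (simp add: rho_tilde_def growth_rate_def)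

lemma rho_tilde_le: "growth_rate A m x0 r \<Longrightarrow> rho_tilde A m x0 \<le> r"
  unfolding rho_tilde_eq_Inf
  by (rule cInf_lower) (auto simp: growth_rate_def intro!: bdd_belowI [of _ 0])

text \<open>
  The invariant set \<open>V\<close> serves two purposes: with the whole space the lemma bounds the growth by an
  operator norm, with an eigenline it gives the modulus of the eigenvalue.
\<close>

lemma growth_rate_constant_signal:
  assumes "h \<in> {1..m}" and "0 \<le> r" and inv: "x0 \<in> V" "\<And>v. v \<in> V \<Longrightarrow> A h *v v \<in> V"
    and step: "\<And>v. v \<in> V \<Longrightarrow> norm (A h *v v) \<le> r * norm v"
  shows "growth_rate A m x0 r"
proof -
  define x where "x k = (((*v) (A h)) ^^ k) x0" for k
  have xS: "x (Suc k) = A h *v x k" for k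
    by (simp add: x_def)
  have "x k \<in> V \<and> norm (x k) \<le> 1 * r ^ k * norm x0" for k
  proof (induction k)
    case 0
    then show ?case using inv by (simp add: x_def)
  next
    case (Suc k)
    have "norm (x (Suc k)) \<le> r * norm (x k)"
      using step Suc by (simp add: xS)
    also have "\<dots> \<le> r * (1 * r ^ k * norm x0)"
      using Suc \<open>0 \<le> r\<close> by (intro mult_left_mono) auto
    finally show ?case
      using Suc inv(2) by (simp add: xS mult_ac)
  qed
  moreover have "switched_solution A m x0 x"
    unfolding switched_solution_def using assms(1) xS
    by (auto simp: x_def intro!: exI [of _ "\<lambda>_. h"])
  ultimately show ?thesis
    using \<open>0 \<le> r\<close> unfolding growth_rate_def by (metis zero_less_one)
qed

text \<open>
  The infimum defining \<open>rho_tilde\<close> runs over a nonempty set, so that a small value of \<open>rho_tilde\<close> is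
  witnessed by an actual solution.
\<close>

lemma growth_rate_exists:
  assumes "h \<in> {1..m}"
  shows "\<exists>r. growth_rate A m x0 r"
proof -
  obtain K where "0 < K" "\<And>v. norm (A h *v v) \<le> K * norm v"
    using linear_bounded_pos [OF matrix_vector_mul_linear] by metis
  then have "growth_rate A m x0 K"
    using assms by (intro growth_rate_constant_signal [where V = UNIV]) auto
  then show ?thesis ..
qed

text \<open>
  The shift of time by one step costs a factor \<open>K / r\<close> in the constant, which the rate does not see.
\<close>

lemma growth_rate_prepend:
  assumes "h \<in> {1..m}" and "0 < r" and "growth_rate A m (A h *v x0) r"
  shows "growth_rate A m x0 r"
proof -
  obtain x \<sigma> M where x: "x 0 = A h *v x0" "\<And>k. \<sigma> k \<in> {1..m}" "\<And>k. x (Suc k) = A (\<sigma> k) *v x k"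
    and M: "0 < M" "\<And>k. norm (x k) \<le> M * r ^ k * norm (A h *v x0)"
    using assms(3) unfolding growth_rate_def switched_solution_def by metis
  obtain K where K: "0 < K" "\<And>v. norm (A h *v v) \<le> K * norm v"
    using linear_bounded_pos [OF matrix_vector_mul_linear] by metis
  \<comment> \<open>the \<open>1\<close> takes care of time \<open>0\<close>, the quotient of all later times\<close>
  define M' where "M' = max 1 (M * K / r)"
  have "switched_solution A m x0 (case_nat x0 x)"
    unfolding switched_solution_def using x assms(1)
    by (auto intro!: exI [of _ "case_nat h \<sigma>"] split: nat.split)
  moreover have "norm (case_nat x0 x k) \<le> M' * r ^ k * norm x0" for k
  proof (cases k)
    case 0
    have "1 * norm x0 \<le> M' * norm x0"
      by (intro mult_right_mono) (auto simp: M'_def)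
    with 0 show ?thesis by simp
  next
    case (Suc j)
    have "norm (x j) \<le> M * r ^ j * (K * norm x0)"
      using M K(2) [of x0] \<open>0 < r\<close> by (meson less_imp_le mult_left_mono mult_nonneg_nonneg order_trans zero_le_power)
    also have "\<dots> = M * K / r * (r ^ k * norm x0)"
      using \<open>0 < r\<close> Suc by simp
    also have "\<dots> \<le> M' * (r ^ k * norm x0)"
      using \<open>0 < r\<close> by (intro mult_right_mono) (auto simp: M'_def)
    finally show ?thesis
      using Suc by (simp add: mult.assoc)
  qed
  moreover have "0 < M'" by (simp add: M'_def)
  ultimately show ?thesis
    using \<open>0 < r\<close> unfolding growth_rate_def by (intro conjI exI [of _ "case_nat x0 x"]) auto
qed

lemma growth_rate_mat_products:
  assumes "P \<in> mat_products A m k" and "0 < r" and "growth_rate A m (P *v x0) r"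
  shows "growth_rate A m x0 r"
  using assms(1,3)
proof (induction k arbitrary: P)
  case 0
  then show ?case by simp
next
  case (Suc k)
  then obtain h Q where hQ: "P = A h ** Q" "h \<in> {1..m}" "Q \<in> mat_products A m k"
    by auto
  then have "growth_rate A m (A h *v (Q *v x0)) r"
    using Suc.prems by (simp add: matrix_vector_mul_assoc)
  then have "growth_rate A m (Q *v x0) r"
    by (rule growth_rate_prepend [OF hQ(2) \<open>0 < r\<close>])
  with Suc.IH hQ show ?case by blast
qed

lemma growth_rate_mat_pow:
  assumes "P \<in> mat_products A m k" and "0 < r" and "growth_rate A m (mat_pow P l *v x0) r"
  shows "growth_rate A m x0 r"
  using assms(3)
proof (induction l)
  case 0
  then show ?case by simp
next
  case (Suc l)
  then show ?case
    using growth_rate_mat_products [OF assms(1,2), of "mat_pow P l *v x0"]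
    by (simp add: matrix_vector_mul_assoc)
qed

section \<open>Points with a slow solution form a null set\<close>

text \<open>
  These are points of norm at least \<open>r\<close> from which \<open>k\<close> steps can lead into the ball of radius \<open>t\<close>.
  The recursion records the norm after each step only through the guaranteed lower bound \<open>\<delta> h * r\<close>.
  This keeps the sets compact and lets the cost of a step be read off from its letter alone.
\<close>

primrec slow_set :: "(nat \<Rightarrow> real^'n^'n) \<Rightarrow> nat \<Rightarrow> (nat \<Rightarrow> real) \<Rightarrow> real \<Rightarrow> nat \<Rightarrow> real \<Rightarrow> (real^'n) set"
  where
  "slow_set A m \<delta> t 0 r = {x. r \<le> norm x \<and> norm x \<le> t}"
| "slow_set A m \<delta> t (Suc k) r = (\<Union>h\<in>{1..m}. {x. A h *v x \<in> slow_set A m \<delta> t k (\<delta> h * r)})"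

lemma measure_linear_vimage:
  fixes A :: "real^'n::{finite,wellorder}^'n::_"
  assumes "invertible A" and "compact S"
  shows "compact {x. A *v x \<in> S}"
    and "measure lebesgue {x. A *v x \<in> S} = measure lebesgue S / \<bar>det A\<bar>"
proof -
  obtain B where B: "A ** B = mat 1" "B ** A = mat 1"
    using assms(1) by (auto simp: invertible_def)
  have inv: "A *v (B *v x) = x" "B *v (A *v x) = x" for x
    by (simp_all add: matrix_vector_mul_assoc B)
  have eq: "{x. A *v x \<in> S} = (*v) B ` S"
    using inv by (auto simp: image_iff) metis
  show c: "compact {x. A *v x \<in> S}"
    unfolding eq using assms(2)
    by (intro compact_continuous_image linear_continuous_on) auto
  have "S = (*v) A ` {x. A *v x \<in> S}"
    using inv by (auto simp: image_iff) metis
  moreover have "measure lebesgue ((*v) A ` {x. A *v x \<in> S}) = \<bar>det A\<bar> * measure lebesgue {x. A *v x \<in> S}"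
    using measure_linear_image [OF matrix_vector_mul_linear lmeasurable_compact [OF c], of A] by simp
  ultimately have "measure lebesgue S = \<bar>det A\<bar> * measure lebesgue {x. A *v x \<in> S}"
    by simp
  then show "measure lebesgue {x. A *v x \<in> S} = measure lebesgue S / \<bar>det A\<bar>"
    using assms(1) by (simp add: invertible_det_nz)
qed

text \<open>
  Invertibility lets each matrix act on volumes through its determinant, the lower bound \<open>\<delta> h\<close> lets
  it act on norms. The measure estimates play these two scales against each other.
\<close>

locale expanding_family =
  fixes A :: "nat \<Rightarrow> real^'n::{finite,wellorder}^'n::_" and m :: nat and \<delta> :: "nat \<Rightarrow> real"
  assumes invertible: "\<And>h. h \<in> {1..m} \<Longrightarrow> invertible (A h)"
    and \<delta>_pos: "\<And>h. h \<in> {1..m} \<Longrightarrow> 0 < \<delta> h"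
    and \<delta>_le: "\<And>h x. h \<in> {1..m} \<Longrightarrow> \<delta> h * norm x \<le> norm (A h *v x)"
begin

lemma compact_slow_set: "compact (slow_set A m \<delta> t k r)"
proof (induction k arbitrary: r)
  case 0
  have "slow_set A m \<delta> t 0 r = cball 0 t \<inter> {x. r \<le> norm x}"
    by auto
  moreover have "closed {x :: real^'n::_. r \<le> norm x}"
    by (intro closed_Collect_le continuous_intros)
  ultimately show ?case
    by (simp only: compact_Int_closed compact_cball)
next
  case (Suc k)
  then have "compact {x. A h *v x \<in> slow_set A m \<delta> t k (\<delta> h * r)}" if "h \<in> {1..m}" for h
    using invertible [OF that] by (intro measure_linear_vimage(1))
  then show ?case
    unfolding slow_set.simps by (intro compact_UN) auto
qed

lemma slow_setI:
  assumes "\<And>j. \<sigma> j \<in> {1..m}" and "\<And>j. x (Suc j) = A (\<sigma> j) *v x j"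
    and "r \<le> norm (x 0)" and "norm (x k) \<le> t"
  shows "x 0 \<in> slow_set A m \<delta> t k r"
  using assms
proof (induction k arbitrary: x \<sigma> r)
  case 0
  then show ?case by simp
next
  case (Suc k)
  have "\<delta> (\<sigma> 0) * r \<le> \<delta> (\<sigma> 0) * norm (x 0)"
    using Suc.prems(1,3) \<delta>_pos by (intro mult_left_mono) (auto intro: less_imp_le)
  also have "\<dots> \<le> norm (x (Suc 0))"
    using Suc.prems(1,2) \<delta>_le by simp
  finally have "x (Suc 0) \<in> slow_set A m \<delta> t k (\<delta> (\<sigma> 0) * r)"
    using Suc.prems by (intro Suc.IH [of "\<lambda>j. \<sigma> (Suc j)" "\<lambda>j. x (Suc j)"]) auto
  with Suc.prems(1,2) show ?case by auto
qed

text \<open>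
  The factor \<open>(t / r) ^ s\<close> is the exponential weight. For \<open>k = 0\<close> it is at least \<open>1\<close> whenever the
  shell is nonempty. At each step the preimage under \<open>A h\<close> divides the volume by \<open>\<bar>det (A h)\<bar>\<close>, and
  the replacement of \<open>r\<close> by \<open>\<delta> h * r\<close> divides the weight by \<open>\<delta> h ^ s\<close>. The bound is therefore
  multiplicative in the letters, and the sum over all words of length \<open>k\<close> is a \<open>k\<close>-th power.
\<close>

lemma measure_slow_set_le:
  assumes "0 < t" and "0 < r"
  shows "measure lebesgue (slow_set A m \<delta> t k r) \<le>
    unit_ball_vol (CARD('n)) * t ^ CARD('n) * (t / r) ^ s
      * (\<Sum>h=1..m. 1 / (\<bar>det (A h)\<bar> * \<delta> h ^ s)) ^ k"
  using \<open>0 < r\<close>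
proof (induction k arbitrary: r)
  case 0
  show ?case
  proof (cases "r \<le> t")
    case True
    have "measure lebesgue (slow_set A m \<delta> t 0 r) \<le> measure lebesgue (cball (0 :: real^'n::_) t)"
      using compact_slow_set [of t 0 r]
      by (intro measure_mono_fmeasurable) (auto intro: fmeasurableD lmeasurable_compact)
    also have "\<dots> = unit_ball_vol (CARD('n)) * t ^ CARD('n) * 1"
      using \<open>0 < t\<close> by (simp add: content_cball)
    also have "\<dots> \<le> unit_ball_vol (CARD('n)) * t ^ CARD('n) * (t / r) ^ s"
      using \<open>0 < t\<close> 0 True by (intro mult_left_mono) (auto intro!: one_le_power simp: less_imp_le)
    finally show ?thesis by simp
  next
    case False
    then have "slow_set A m \<delta> t 0 r = {}" by auto
    then have "measure lebesgue (slow_set A m \<delta> t 0 r) = 0"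
      by (simp only: measure_empty)
    moreover have "0 \<le> unit_ball_vol (CARD('n)) * t ^ CARD('n) * (t / r) ^ s"
      using \<open>0 < t\<close> 0 by simp
    ultimately show ?thesis by simp
  qed
next
  case (Suc k)
  let ?K = "\<Sum>h=1..m. 1 / (\<bar>det (A h)\<bar> * \<delta> h ^ s)"
  let ?V = "unit_ball_vol (CARD('n)) * t ^ CARD('n)"
  have "measure lebesgue (slow_set A m \<delta> t (Suc k) r)
      \<le> (\<Sum>h=1..m. measure lebesgue {x. A h *v x \<in> slow_set A m \<delta> t k (\<delta> h * r)})"
    unfolding slow_set.simps
    by (intro measure_UNION_le fmeasurableD lmeasurable_compact measure_linear_vimage(1)
        invertible compact_slow_set finite_atLeastAtMost)
  also have "\<dots> \<le> (\<Sum>h=1..m. ?V * (t / r) ^ s * ?K ^ k * (1 / (\<bar>det (A h)\<bar> * \<delta> h ^ s)))"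
  proof (rule sum_mono)
    fix h assume h: "h \<in> {1..m}"
    then have "measure lebesgue {x. A h *v x \<in> slow_set A m \<delta> t k (\<delta> h * r)}
        = measure lebesgue (slow_set A m \<delta> t k (\<delta> h * r)) / \<bar>det (A h)\<bar>"
      by (intro measure_linear_vimage(2) invertible compact_slow_set)
    also have "\<dots> \<le> (?V * (t / (\<delta> h * r)) ^ s * ?K ^ k) / \<bar>det (A h)\<bar>"
      using Suc.prems \<delta>_pos [OF h] by (intro divide_right_mono Suc.IH) auto
    also have "\<dots> = ?V * (t / r) ^ s * ?K ^ k * (1 / (\<bar>det (A h)\<bar> * \<delta> h ^ s))"
      by (simp add: power_divide power_mult_distrib)
    finally show "measure lebesgue {x. A h *v x \<in> slow_set A m \<delta> t k (\<delta> h * r)} \<le> \<dots>" .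
  qed
  also have "\<dots> = ?V * (t / r) ^ s * ?K ^ Suc k"
    unfolding sum_distrib_left [symmetric] by simp
  finally show ?case .
qed

text \<open>
  A point whose value lies below \<open>\<gamma>\<close> belongs, for some positive \<open>r\<close> and \<open>c\<close>, to all slow sets with
  target radius \<open>c * \<gamma> ^ k\<close>. Their measures decay like the \<open>k\<close>-th power of the left-hand side of the
  smallness assumption, and countably many pairs \<open>(r, c)\<close> suffice.
\<close>

lemma negligible_rho_tilde_less:
  assumes "0 < \<gamma>" and "1 \<le> m"
    and small: "\<gamma> ^ (CARD('n) + s) * (\<Sum>h=1..m. 1 / (\<bar>det (A h)\<bar> * \<delta> h ^ s)) < 1"
  shows "negligible {x. x \<noteq> 0 \<and> rho_tilde A m x < \<gamma>}"
proof -
  define K where "K = (\<Sum>h=1..m. 1 / (\<bar>det (A h)\<bar> * \<delta> h ^ s))"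
  define q where "q = \<gamma> ^ (CARD('n) + s) * K"
  have "0 \<le> K"
    unfolding K_def using \<delta>_pos by (intro sum_nonneg) (auto simp: less_imp_le)
  then have q: "0 \<le> q" "q < 1"
    using assms by (auto simp: q_def K_def)
  define N where "N r c = (\<Inter>k. slow_set A m \<delta> (c * \<gamma> ^ k) k r)" for r c
  have neg: "negligible (N r c)" if "0 < r" "0 < c" for r c
    unfolding negligible_outer_le
  proof (intro allI impI)
    fix e :: real assume "0 < e"
    define C where "C = unit_ball_vol (CARD('n)) * c ^ CARD('n) * (c / r) ^ s"
    have "(\<lambda>k. C * q ^ k) \<longlonglongrightarrow> C * 0"
      using q by (intro tendsto_intros LIMSEQ_power_zero) auto
    then have "eventually (\<lambda>k. C * q ^ k < e) sequentially"
      using \<open>0 < e\<close> by (intro order_tendstoD(2)) auto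
    then obtain k where k: "C * q ^ k < e"
      by (auto simp: eventually_sequentially)
    let ?T = "slow_set A m \<delta> (c * \<gamma> ^ k) k r"
    have "measure lebesgue ?T \<le> unit_ball_vol (CARD('n)) * (c * \<gamma> ^ k) ^ CARD('n) * (c * \<gamma> ^ k / r) ^ s * K ^ k"
      unfolding K_def using that \<open>0 < \<gamma>\<close> by (intro measure_slow_set_le) auto
    also have "\<dots> = C * q ^ k"
      by (simp add: C_def q_def power_mult_distrib power_divide power_add power_mult [symmetric] mult.commute)
    finally have "measure lebesgue ?T \<le> e"
      using k by simp
    moreover have "N r c \<subseteq> ?T" by (auto simp: N_def)
    ultimately show "\<exists>T. N r c \<subseteq> T \<and> T \<in> lmeasurable \<and> measure lebesgue T \<le> e"
      using lmeasurable_compact [OF compact_slow_set] by blast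
  qed
  have "{x. x \<noteq> 0 \<and> rho_tilde A m x < \<gamma>} \<subseteq> (\<Union>i. \<Union>j. N (1 / real (Suc i)) (real (Suc j)))"
  proof
    fix x0 assume x0: "x0 \<in> {x. x \<noteq> 0 \<and> rho_tilde A m x < \<gamma>}"
    have "{r. growth_rate A m x0 r} \<noteq> {}"
      using growth_rate_exists [of m m A x0] \<open>1 \<le> m\<close> by auto
    then obtain r where r: "growth_rate A m x0 r" "r < \<gamma>"
      using x0 cInf_lessD [of "{r. growth_rate A m x0 r}" \<gamma>] by (auto simp: rho_tilde_eq_Inf)
    then obtain x \<sigma> M where "0 \<le> r" "0 < M" and x: "x 0 = x0" "\<And>k. \<sigma> k \<in> {1..m}"
        "\<And>k. x (Suc k) = A (\<sigma> k) *v x k" and M: "\<And>k. norm (x k) \<le> M * r ^ k * norm x0"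
      unfolding growth_rate_def switched_solution_def by metis
    obtain i where "inverse (real (Suc i)) < norm x0"
      using reals_Archimedean [of "norm x0"] x0 by auto
    then have i: "1 / real (Suc i) \<le> norm x0"
      by (simp add: inverse_eq_divide)
    obtain j where "M * norm x0 < real j"
      using reals_Archimedean2 by blast
    then have j: "M * norm x0 \<le> real (Suc j)" by simp
    have "norm (x k) \<le> real (Suc j) * \<gamma> ^ k" for k
    proof -
      have "norm (x k) \<le> (M * norm x0) * r ^ k"
        using M [of k] by (simp add: mult_ac)
      also have "\<dots> \<le> real (Suc j) * \<gamma> ^ k"
        using j \<open>0 \<le> r\<close> r(2) \<open>0 < M\<close> by (intro mult_mono power_mono) auto
      finally show ?thesis .
    qed
    then have "x0 \<in> N (1 / real (Suc i)) (real (Suc j))"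
      unfolding N_def using slow_setI [of \<sigma> x] x i by auto
    then show "x0 \<in> (\<Union>i. \<Union>j. N (1 / real (Suc i)) (real (Suc j)))" by blast
  qed
  moreover have "negligible (\<Union>i. \<Union>j. N (1 / real (Suc i)) (real (Suc j)))"
    by (intro negligible_Union_nat neg) auto
  ultimately show ?thesis
    using negligible_subset by blast
qed

text \<open>
  At the rate \<open>\<delta> b\<close> the quantity of the smallness assumption tends to \<open>\<delta> b ^ n / \<bar>det (A b)\<bar> < 1\<close>
  as \<open>s\<close> grows, because the other letters contribute powers of \<open>\<delta> b / \<delta> h < 1\<close>. Once \<open>s\<close> is fixed,
  continuity leaves room for a rate slightly above \<open>\<delta> b\<close>.
\<close>

lemma rho_tilde_gap:
  assumes b: "b \<in> {1..m}" and min: "\<And>h. h \<in> {1..m} \<Longrightarrow> h \<noteq> b \<Longrightarrow> \<delta> b < \<delta> h"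
    and det: "\<delta> b ^ CARD('n) < \<bar>det (A b)\<bar>"
  obtains \<gamma> where "\<delta> b < \<gamma>" "negligible {x. x \<noteq> 0 \<and> rho_tilde A m x < \<gamma>}"
proof -
  define d where "d = \<delta> b"
  have "0 < d" using b \<delta>_pos by (simp add: d_def)
  let ?K = "\<lambda>s. \<Sum>h=1..m. 1 / (\<bar>det (A h)\<bar> * \<delta> h ^ s)"
  have K: "d ^ (CARD('n) + s) * ?K s = (\<Sum>h=1..m. d ^ CARD('n) / \<bar>det (A h)\<bar> * (d / \<delta> h) ^ s)" for s
    by (simp add: sum_distrib_left power_add power_divide)
  have "(\<lambda>s. d ^ CARD('n) / \<bar>det (A h)\<bar> * (d / \<delta> h) ^ s)
      \<longlonglongrightarrow> (if h = b then d ^ CARD('n) / \<bar>det (A b)\<bar> else 0)" if h: "h \<in> {1..m}" for h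
  proof (cases "h = b")
    case True
    with \<open>0 < d\<close> show ?thesis by (simp add: d_def)
  next
    case False
    have "(\<lambda>s. d ^ CARD('n) / \<bar>det (A h)\<bar> * (d / \<delta> h) ^ s) \<longlonglongrightarrow> d ^ CARD('n) / \<bar>det (A h)\<bar> * 0"
      using min [OF h False] \<delta>_pos [OF h] \<open>0 < d\<close>
      by (intro tendsto_intros LIMSEQ_power_zero) (auto simp: d_def)
    with False show ?thesis by simp
  qed
  then have "(\<lambda>s. d ^ (CARD('n) + s) * ?K s)
      \<longlonglongrightarrow> (\<Sum>h=1..m. if h = b then d ^ CARD('n) / \<bar>det (A b)\<bar> else 0)"
    unfolding K by (rule tendsto_sum)
  also have "(\<Sum>h=1..m. if h = b then d ^ CARD('n) / \<bar>det (A b)\<bar> else 0) = d ^ CARD('n) / \<bar>det (A b)\<bar>"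
    using b by simp
  finally have lim: "(\<lambda>s. d ^ (CARD('n) + s) * ?K s) \<longlonglongrightarrow> d ^ CARD('n) / \<bar>det (A b)\<bar>" .
  have "d ^ CARD('n) / \<bar>det (A b)\<bar> < 1"
    using det \<open>0 < d\<close> by (simp add: d_def divide_less_eq)
  with lim have "eventually (\<lambda>s. d ^ (CARD('n) + s) * ?K s < 1) sequentially"
    by (rule order_tendstoD(2))
  then obtain s where s: "d ^ (CARD('n) + s) * ?K s < 1"
    by (auto simp: eventually_sequentially)
  have "((\<lambda>\<gamma>. \<gamma> ^ (CARD('n) + s) * ?K s) \<longlongrightarrow> d ^ (CARD('n) + s) * ?K s) (at_right d)"
    by (intro tendsto_intros)
  then have "eventually (\<lambda>\<gamma>. \<gamma> ^ (CARD('n) + s) * ?K s < 1) (at_right d)"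
    using s by (rule order_tendstoD(2))
  moreover have "eventually (\<lambda>\<gamma>. d < \<gamma>) (at_right d)"
    by (simp add: eventually_at_filter)
  ultimately have "eventually (\<lambda>\<gamma>. d < \<gamma> \<and> \<gamma> ^ (CARD('n) + s) * ?K s < 1) (at_right d)"
    by eventually_elim auto
  then obtain \<gamma> where \<gamma>: "d < \<gamma>" "\<gamma> ^ (CARD('n) + s) * ?K s < 1"
    using eventually_happens' [OF trivial_limit_at_right_real] by blast
  show thesis
  proof (rule that)
    show "negligible {x. x \<noteq> 0 \<and> rho_tilde A m x < \<gamma>}"
      using \<gamma> b \<open>0 < d\<close> by (intro negligible_rho_tilde_less) auto
  qed (use \<gamma> in \<open>simp add: d_def\<close>)
qed

end

section \<open>Discontinuity at every point\<close>

lemma not_isCont_if_dense_gap: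
  fixes f :: "'a::metric_space \<Rightarrow> real"
  assumes low: "\<And>e. 0 < e \<Longrightarrow> \<exists>y. dist y x < e \<and> f y \<le> a"
    and high: "\<And>e. 0 < e \<Longrightarrow> \<exists>y. dist y x < e \<and> b \<le> f y" and "a < b"
  shows "\<not> isCont f x"
proof
  assume "isCont f x"
  moreover have "0 < (b - a) / 2" using \<open>a < b\<close> by simp
  ultimately obtain e where e: "0 < e" "\<And>y. dist y x < e \<Longrightarrow> dist (f y) (f x) < (b - a) / 2"
    unfolding continuous_at_eps_delta by metis
  obtain y z where "dist y x < e" "f y \<le> a" "dist z x < e" "b \<le> f z"
    using low high e(1) by metis
  with e(2) [of y] e(2) [of z] show False
    unfolding dist_real_def by argo
qed

(* not_reflection excludes A hb = c * diag(1,-1). There both singular values of A hb coincide and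
   rho_tilde is constant away from 0, so the claim fails. *)
theorem proposition3:
  fixes A :: "nat \<Rightarrow> real^2^2" and m hb :: nat
  assumes nonsingular: "\<And>h. h \<in> {1..m} \<Longrightarrow> invertible (A h)"
    and rotation: "\<exists>B \<in> (\<Union>k. mat_products A m k). has_nonreal_eigenvalue B \<and>
          (\<forall>l::int. l \<noteq> 0 \<longrightarrow> \<not> proportional_to_id (mat_powi B l))"
    and single_min: "{h \<in> {1..m}. min_singular_value (A h) =
          Min ((\<lambda>h. min_singular_value (A h)) ` {1..m})} = {hb}"
    and diagonal: "is_diagonal (A hb)"
    and not_scalar: "\<not> proportional_to_id (A hb)"
    and not_reflection: "A hb $ 1 $ 1 \<noteq> - A hb $ 2 $ 2"
  shows "\<forall>x. \<not> isCont (rho_tilde A m) x"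
proof
  fix x
  define \<delta> where "\<delta> h = min_singular_value (A h)" for h
  have "hb \<in> {h \<in> {1..m}. \<delta> h = Min (\<delta> ` {1..m})}"
    unfolding \<delta>_def single_min by simp
  then have Min: "Min (\<delta> ` {1..m}) = \<delta> hb" and hb: "hb \<in> {1..m}"
    by simp_all
  have min: "\<delta> hb < \<delta> h" if "h \<in> {1..m}" "h \<noteq> hb" for h
  proof -
    have "\<delta> hb \<le> \<delta> h"
      using Min that(1) by (metis Min_le finite_atLeastAtMost finite_imageI imageI)
    moreover have "\<delta> h \<noteq> \<delta> hb"
    proof
      assume "\<delta> h = \<delta> hb"
      with that(1) Min have "h \<in> {h \<in> {1..m}. \<delta> h = Min (\<delta> ` {1..m})}"
        by simp
      then show False
        using that(2) unfolding \<delta>_def single_min by simp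
    qed
    ultimately show ?thesis by simp
  qed
  interpret expanding_family A m \<delta>
    by standard (auto simp: \<delta>_def nonsingular min_singular_value_pos_2 norm_mult_ge_min_singular_value_2)

  define a d where "a = A hb $ 1 $ 1" and "d = A hb $ 2 $ 2"
  have off: "A hb $ 1 $ 2 = 0" "A hb $ 2 $ 1 = 0"
    using diagonal by (simp_all add: is_diagonal_def)
  have \<delta>_hb: "\<delta> hb = min \<bar>a\<bar> \<bar>d\<bar>"
    by (simp add: \<delta>_def a_def d_def min_singular_value_diagonal_2 [OF diagonal])
  have \<delta>_hb_pos: "0 < \<delta> hb"
    using hb by (rule \<delta>_pos)
  \<comment> \<open>the two singular values of the diagonal matrix differ, so the determinant exceeds \<open>\<delta>\<^sup>2\<close>\<close>
  have "a \<noteq> d"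
  proof
    assume "a = d"
    then have "A hb = a *\<^sub>R mat 1"
      using off by (simp add: vec_eq_iff forall_2 mat_def a_def d_def)
    with not_scalar show False by (auto simp: proportional_to_id_def)
  qed
  with not_reflection have "\<bar>a\<bar> \<noteq> \<bar>d\<bar>"
    by (auto simp: a_def d_def abs_eq_iff)
  moreover have "min p q * min p q < p * q" if "0 < min p q" "p \<noteq> q" for p q :: real
    using that by (auto simp: min_def)
  ultimately have "\<delta> hb * \<delta> hb < \<bar>a\<bar> * \<bar>d\<bar>"
    using \<delta>_hb_pos unfolding \<delta>_hb by metis
  then have "\<delta> hb ^ CARD(2) < \<bar>det (A hb)\<bar>"
    by (simp add: det_2 off a_def d_def power2_eq_square abs_mult)
  then obtain \<gamma> where \<gamma>: "\<delta> hb < \<gamma>" "negligible {y. y \<noteq> 0 \<and> rho_tilde A m y < \<gamma>}"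
    using rho_tilde_gap [OF hb min] by blast

  \<comment> \<open>the coordinate axis on which \<open>A hb\<close> contracts most\<close>
  obtain i where i: "\<bar>A hb $ i $ i\<bar> = \<delta> hb"
    unfolding \<delta>_hb a_def d_def by (metis min_def)
  define e :: "real^2" where "e = axis i 1"
  have e: "A hb *v e = (A hb $ i $ i) *\<^sub>R e"
    unfolding e_def matrix_vector_mult_basis
    using diagonal by (auto simp: column_def vec_eq_iff axis_def is_diagonal_def)
  have slow: "growth_rate A m (t *\<^sub>R e) (\<delta> hb)" for t
  proof (rule growth_rate_constant_signal [OF hb, where V = "range (\<lambda>t. t *\<^sub>R e)"])
    fix v assume "v \<in> range (\<lambda>t. t *\<^sub>R e)"
    then have v: "A hb *v v = (A hb $ i $ i) *\<^sub>R v"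
      using e by (auto simp: matrix_vector_mult_scaleR)
    then show "norm (A hb *v v) \<le> \<delta> hb * norm v"
      by (simp add: i)
    from v \<open>v \<in> _\<close> show "A hb *v v \<in> range (\<lambda>t. t *\<^sub>R e)"
      by auto
  qed (use \<delta>_hb_pos in auto)

  obtain B n where B: "B \<in> mat_products A m n" "has_nonreal_eigenvalue B"
    and powi: "\<And>l::int. l \<noteq> 0 \<Longrightarrow> \<not> proportional_to_id (mat_powi B l)"
    using rotation by blast
  have pow: "\<not> proportional_to_id (mat_pow B l)" if "0 < l" for l
    using powi [of "int l"] that by (simp add: mat_powi_def)

  show "\<not> isCont (rho_tilde A m) x"
  proof (rule not_isCont_if_dense_gap [OF _ _ \<gamma>(1)])
    fix \<epsilon> :: real assume "0 < \<epsilon>"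
    have "e \<noteq> 0" by (simp add: e_def axis_eq_0_iff)
    then obtain y k t where "dist y x < \<epsilon>" "mat_pow B k *v y = t *\<^sub>R e"
      using preimages_of_line_dense [OF B(2) pow] \<open>0 < \<epsilon>\<close> by metis
    with slow show "\<exists>y. dist y x < \<epsilon> \<and> rho_tilde A m y \<le> \<delta> hb"
      by (metis growth_rate_mat_pow [OF B(1) \<delta>_hb_pos] rho_tilde_le)
  next
    fix \<epsilon> :: real assume "0 < \<epsilon>"
    have "negligible (insert 0 {y. y \<noteq> 0 \<and> rho_tilde A m y < \<gamma>})"
      using \<gamma>(2) by simp
    moreover have "\<not> negligible (ball x \<epsilon>)"
      using \<open>0 < \<epsilon>\<close> by (intro open_not_negligible) auto
    ultimately have "\<not> ball x \<epsilon> \<subseteq> insert 0 {y. y \<noteq> 0 \<and> rho_tilde A m y < \<gamma>}"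
      using negligible_subset by blast
    then show "\<exists>y. dist y x < \<epsilon> \<and> \<gamma> \<le> rho_tilde A m y"
      by (auto simp: subset_iff dist_commute not_less)
  qed
qed

end
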